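(* For every $\textit{LTL}_f$ formula $\phi$, if the propositional formula $\mathit{off}(\phi)$ is satisfiable (i.e. there is $A\in\Sigma$ with $A\models\mathit{off}(\phi)$), then $\phi$ is satisfiable as an $\textit{LTL}_f$ formula.
   Context: Fix a finite set $\mathcal{P}$ of atomic propositions; $L=\mathcal{P}\cup\{\neg a: a\in\mathcal{P}\}$ is the set of literals and $\Sigma=2^{L}$. $\textit{LTL}_f$ formulas are in negation normal form: $\phi::=\mathsf{tt}\mid\mathsf{ff}\mid \ell\mid \phi\wedge\phi\mid\phi\vee\phi\mid X\phi\mid X_w\phi\mid \phi U\phi\mid\phi R\phi$, $\ell\in L$. Semantics on finite traces $\eta=\omega_0\ldots\omega_n\in\Sigma^*$ ($n\ge0$, $|\eta|=n+1$, $\eta_i=\omega_i\ldots\omega_n$): $\eta\models\mathsf{tt}$, $\eta\not\models\mathsf{ff}$; $\eta\models\ell$ iff $\ell\in\omega_0$; $\wedge,\vee$ as usual; $\eta\models X\psi$ iff $|\eta|>1$ and $\eta_1\models\psi$; $\eta\models X_w\psi$ iff $|\eta|=1$ or ($|\eta|>1$ and $\eta_1\models\psi$); $\eta\models\phi_1U\phi_2$ iff some $0\le i<|\eta|$ has $\eta_i\models\phi_2$ and $\eta_j\models\phi_1$ for all $j<i$; $\eta\models\phi_1R\phi_2$ iff either $\eta_i\models\phi_2$ for all $0\le i<|\eta|$, or some $0\le i<|\eta|$ has $\eta_i\models\phi_1$ and $\eta_j\models\phi_2$ for all $j\le i$. $\phi$ is satisfiable iff some finite trace satisfies it. A letter $A\in\Sigma$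 is identified with the length-one trace, so $A\models\alpha$ is defined for propositional $\alpha$. Obligation formulas $\mathit{off},\mathit{ofr},\mathit{ofg}$ (propositional formulas), defined by induction; for $\mathit{ofx}$ ranging over all three: $\mathit{ofx}(\mathsf{tt})=\mathsf{tt}$, $\mathit{ofx}(\mathsf{ff})=\mathsf{ff}$, $\mathit{ofx}(\ell)=\ell$ for literals; $\mathit{ofx}(\phi_1\wedge\phi_2)=\mathit{ofx}(\phi_1)\wedge\mathit{ofx}(\phi_2)$; $\mathit{ofx}(\phi_1\vee\phi_2)=\mathit{ofx}(\phi_1)\vee\mathit{ofx}(\phi_2)$; $\mathit{ofx}(\phi_1U\phi_2)=\mathit{ofx}(\phi_2)$. For Next: $\mathit{off}(X\phi_2)=\mathit{off}(\phi_2)$, $\mathit{ofr}(X\phi_2)=\mathsf{ff}$, $\mathit{ofg}(X\phi_2)=\mathsf{ff}$; $\mathit{off}(X_w\phi_2)=\mathit{off}(\phi_2)$, $\mathit{ofr}(X_w\phi_2)=\mathsf{ff}$, $\mathit{ofg}(X_w\phi_2)=\mathsf{tt}$. For Release: $\mathit{off}(\phi_1R\phi_2)=\mathit{ofr}(\phi_2)$, $\mathit{ofr}(\phi_1R\phi_2)=\mathit{ofr}(\phi_2)$, $\mathit{ofg}(\phi_1R\phi_2)=\mathit{ofg}(\phi_2)$. *)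

theory Defs
  imports Main
begin

datatype 'a literal = Pos 'a | Neg 'a

definition literals :: "'a set \<Rightarrow> 'a literal set" where
  "literals P = Pos ` P \<union> Neg ` P"

text \<open>A letter is an arbitrary set of literals: it need not be consistent, i.e. it may contain
  both a proposition and its negation, and it need not decide every proposition.\<close>

definition letters :: "'a set \<Rightarrow> 'a literal set set" where
  "letters P = Pow (literals P)"

definition traces :: "'a set \<Rightarrow> 'a literal set list set" where
  "traces P = {\<eta>. \<eta> \<noteq> [] \<and> set \<eta> \<subseteq> letters P}"

datatype (props: 'a) ltlf =
    TT
  | FF
  | Lit "'a literal"
  | And "'a ltlf" "'a ltlf"
  | Or "'a ltlf" "'a ltlf"
  | Next "'a ltlf"
  | WNext "'a ltlf"
  | Until "'a ltlf" "'a ltlf"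
  | Release "'a ltlf" "'a ltlf"

definition formulas :: "'a set \<Rightarrow> 'a ltlf set" where
  "formulas P = {\<phi>. props \<phi> \<subseteq> P}"

text \<open>The suffix of a trace \<open>\<eta>\<close> starting at position \<open>i\<close> is \<open>drop i \<eta>\<close>. The relation is meaningful
  for nonempty traces only; on these, the clauses only refer to nonempty suffixes.\<close>

primrec models :: "'a literal set list \<Rightarrow> 'a ltlf \<Rightarrow> bool" (infix "\<Turnstile>" 50) where
  "\<eta> \<Turnstile> TT \<longleftrightarrow> True"
| "\<eta> \<Turnstile> FF \<longleftrightarrow> False"
| "\<eta> \<Turnstile> Lit l \<longleftrightarrow> l \<in> hd \<eta>"
| "\<eta> \<Turnstile> And \<phi> \<psi> \<longleftrightarrow> \<eta> \<Turnstile> \<phi> \<and> \<eta> \<Turnstile> \<psi>"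
| "\<eta> \<Turnstile> Or \<phi> \<psi> \<longleftrightarrow> \<eta> \<Turnstile> \<phi> \<or> \<eta> \<Turnstile> \<psi>"
| "\<eta> \<Turnstile> Next \<psi> \<longleftrightarrow> length \<eta> > 1 \<and> drop 1 \<eta> \<Turnstile> \<psi>"
| "\<eta> \<Turnstile> WNext \<psi> \<longleftrightarrow> length \<eta> = 1 \<or> (length \<eta> > 1 \<and> drop 1 \<eta> \<Turnstile> \<psi>)"
| "\<eta> \<Turnstile> Until \<phi> \<psi> \<longleftrightarrow>
     (\<exists>i<length \<eta>. drop i \<eta> \<Turnstile> \<psi> \<and> (\<forall>j<i. drop j \<eta> \<Turnstile> \<phi>))"
| "\<eta> \<Turnstile> Release \<phi> \<psi> \<longleftrightarrow>
     (\<forall>i<length \<eta>. drop i \<eta> \<Turnstile> \<psi>) \<or>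
     (\<exists>i<length \<eta>. drop i \<eta> \<Turnstile> \<phi> \<and> (\<forall>j\<le>i. drop j \<eta> \<Turnstile> \<psi>))"

definition satisfiable :: "'a set \<Rightarrow> 'a ltlf \<Rightarrow> bool" where
  "satisfiable P \<phi> \<longleftrightarrow> (\<exists>\<eta>\<in>traces P. \<eta> \<Turnstile> \<phi>)"

text \<open>Propositional formulas are the formulas without temporal operators, evaluated at a letter
  by viewing it as a trace of length one.\<close>

primrec propositional :: "'a ltlf \<Rightarrow> bool" where
  "propositional TT \<longleftrightarrow> True"
| "propositional FF \<longleftrightarrow> True"
| "propositional (Lit l) \<longleftrightarrow> True"
| "propositional (And \<phi> \<psi>) \<longleftrightarrow> propositional \<phi> \<and> propositional \<psi>"
| "propositional (Or \<phi> \<psi>) \<longleftrightarrow> propositional \<phi> \<and> propositional \<psi>"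
| "propositional (Next \<psi>) \<longleftrightarrow> False"
| "propositional (WNext \<psi>) \<longleftrightarrow> False"
| "propositional (Until \<phi> \<psi>) \<longleftrightarrow> False"
| "propositional (Release \<phi> \<psi>) \<longleftrightarrow> False"

definition prop_satisfiable :: "'a set \<Rightarrow> 'a ltlf \<Rightarrow> bool" where
  "prop_satisfiable P \<alpha> \<longleftrightarrow> (\<exists>A\<in>letters P. [A] \<Turnstile> \<alpha>)"

primrec ofg :: "'a ltlf \<Rightarrow> 'a ltlf" where
  "ofg TT = TT"
| "ofg FF = FF"
| "ofg (Lit l) = Lit l"
| "ofg (And \<phi> \<psi>) = And (ofg \<phi>) (ofg \<psi>)"
| "ofg (Or \<phi> \<psi>) = Or (ofg \<phi>) (ofg \<psi>)"
| "ofg (Next \<psi>) = FF"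
| "ofg (WNext \<psi>) = TT"
| "ofg (Until \<phi> \<psi>) = ofg \<psi>"
| "ofg (Release \<phi> \<psi>) = ofg \<psi>"

primrec ofr :: "'a ltlf \<Rightarrow> 'a ltlf" where
  "ofr TT = TT"
| "ofr FF = FF"
| "ofr (Lit l) = Lit l"
| "ofr (And \<phi> \<psi>) = And (ofr \<phi>) (ofr \<psi>)"
| "ofr (Or \<phi> \<psi>) = Or (ofr \<phi>) (ofr \<psi>)"
| "ofr (Next \<psi>) = FF"
| "ofr (WNext \<psi>) = FF"
| "ofr (Until \<phi> \<psi>) = ofr \<psi>"
| "ofr (Release \<phi> \<psi>) = ofr \<psi>"

primrec off :: "'a ltlf \<Rightarrow> 'a ltlf" where
  "off TT = TT"
| "off FF = FF"
| "off (Lit l) = Lit l"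
| "off (And \<phi> \<psi>) = And (off \<phi>) (off \<psi>)"
| "off (Or \<phi> \<psi>) = Or (off \<phi>) (off \<psi>)"
| "off (Next \<psi>) = off \<psi>"
| "off (WNext \<psi>) = off \<psi>"
| "off (Until \<phi> \<psi>) = off \<psi>"
| "off (Release \<phi> \<psi>) = ofr \<psi>"

lemma propositional_ofg: "propositional (ofg \<phi>)"
  by (induction \<phi>) simp_all

lemma propositional_ofr: "propositional (ofr \<phi>)"
  by (induction \<phi>) simp_all

lemma propositional_off: "propositional (off \<phi>)"
  by (induction \<phi>) (simp_all add: propositional_ofr)

end

(* The obligation off collects what the letter A must satisfy for the constant trace A^n to be a
   model of the formula for all sufficiently large n. Under Release every suffix of the trace has to
   satisfy the body, including short ones; there ofr, which forbids Next, guarantees that A^n is a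
   model for every n > 0. *)
theory Submission imports Defs begin

text \<open>The suffixes starting inside a constant trace are nonempty constant traces, so an
  induction hypothesis for all lengths settles Release; Until is fulfilled at position
  \<open>0\<close>.\<close>

lemma replicate_models_if_ofr:
  assumes "[A] \<Turnstile> ofr \<phi>" and "n > 0"
  shows "replicate n A \<Turnstile> \<phi>"
  using assms by (induction \<phi> arbitrary: n) (auto intro: exI[of _ "0::nat"])

text \<open>Each Next or weak Next consumes one letter, and \<open>size \<phi>\<close> is a crude
  bound on their nesting depth.\<close>

lemma replicate_models_if_off:
  assumes "[A] \<Turnstile> off \<phi>" and "n > size \<phi>"
  shows "replicate n A \<Turnstile> \<phi>"
  using assms
  by (induction \<phi> arbitrary: n) (auto simp: replicate_models_if_ofr intro: exI[of _ "0::nat"])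

theorem theorem4:
  fixes P :: "'a set" and \<phi> :: "'a ltlf"
  assumes "finite P"
    and "\<phi> \<in> formulas P"
    and "prop_satisfiable P (off \<phi>)"
  shows "satisfiable P \<phi>"
proof -
  obtain A where A: "A \<in> letters P" "[A] \<Turnstile> off \<phi>"
    using assms(3) by (auto simp: prop_satisfiable_def)
  \<comment> \<open>\<open>Suc\<close> gives the strict length bound and makes the trace
    nonempty.\<close>
  let ?\<eta> = "replicate (Suc (size \<phi>)) A"
  have "?\<eta> \<in> traces P"
    using A(1) by (auto simp: traces_def)
  moreover have "?\<eta> \<Turnstile> \<phi>"
    using A(2) by (rule replicate_models_if_off) simp
  ultimately show ?thesis
    by (auto simp: satisfiable_def)
qed

end
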